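(* Let $G$ be the elementary abelian $2$-group of order $n=2^r$. (1) For each integer $h$ with $n/2-1\le h\le n-2$ we have $C_h(G)=h+2$. (2) For each integer $h$ with $4\le h\le n/2-2$ we have $n/2\le C_h(G)\le n/2+h-2$.
   Context: $G$ is written additively. For $A\subseteq G$ and a positive integer $h$, $h\hat{\;}A$ denotes the set of all sums of $h$ pairwise distinct elements of $A$. $C_h(G)=\max\{|A| : A\subseteq G,\ h\hat{\;}A\neq G\}$. *)

theory Defs
  imports Complex_Main "HOL-Library.Cardinality"
begin

definition restricted_sumset :: "nat \<Rightarrow> 'a::ab_group_add set \<Rightarrow> 'a set" where
  "restricted_sumset h A = {(\<Sum>x\<in>B. x) | B. B \<subseteq> A \<and> finite B \<and> card B = h}"

text \<open>
  The maximum is over a nonempty set when \<open>h \<ge> 1\<close>, as \<open>A = {}\<close> qualifies; for \<open>h = 0\<close> and a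
  trivial group the value is unspecified.
\<close>

definition crit_num :: "'a::{ab_group_add, finite} itself \<Rightarrow> nat \<Rightarrow> nat" where
  "crit_num _ h = Max {card A | A :: 'a set. restricted_sumset h A \<noteq> UNIV}"

end

(* In an elementary abelian 2-group, |A| >= n/2 + 2 forces 3^A = G: after translating the target
   to 0 and discarding 0, the sets B and B + c (c in B) are too large to be disjoint, and a common
   element a = b + c gives a + b + c = 0. Taking complements inside a set of size h + k turns
   h-fold sums into k-fold ones: k = 2 shows that a set of size h + 2 misses its own sum, and k = 3
   gives the upper bound in (1). Setting one summand aside at a time extends the case of 3 summands
   to |A| >= n/2 + h - 1, the upper bound in (2); a maximal proper subgroup gives the lower one. *)

theory Submission
  imports Defs
begin

lemma restricted_sumset_mono:
  assumes "A \<subseteq> B"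
  shows "restricted_sumset h A \<subseteq> restricted_sumset h B"
  using assms unfolding restricted_sumset_def by blast

lemma restricted_sumset_complement:
  fixes A :: "'a::ab_group_add set"
  assumes "finite A" and card_A: "card A = h + k"
  shows "restricted_sumset h A = (\<lambda>s. \<Sum>A - s) ` restricted_sumset k A"
proof
  \<comment> \<open>The map \<open>s \<mapsto> \<Sum>A - s\<close> is an involution, so this one
    inclusion, used for \<open>(h, k)\<close> and then for \<open>(k, h)\<close>, gives both
    directions.\<close>
  have "restricted_sumset i A \<subseteq> (\<lambda>s. \<Sum>A - s) ` restricted_sumset j A"
    if "card A = i + j" for i j
  proof
    fix s assume "s \<in> restricted_sumset i A"
    then obtain B where B: "B \<subseteq> A" "finite B" "card B = i" "s = \<Sum>B"
      unfolding restricted_sumset_def by blast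
    have "card (A - B) = j"
      using B that by (simp add: card_Diff_subset)
    then have "\<Sum>(A - B) \<in> restricted_sumset j A"
      unfolding restricted_sumset_def using \<open>finite A\<close> by blast
    moreover have "s = \<Sum>A - \<Sum>(A - B)"
      using B \<open>finite A\<close> by (simp add: sum_diff)
    ultimately show "s \<in> (\<lambda>s. \<Sum>A - s) ` restricted_sumset j A"
      by blast
  qed
  note * = this
  show "restricted_sumset h A \<subseteq> (\<lambda>s. \<Sum>A - s) ` restricted_sumset k A"
    using *[OF card_A] .
  show "(\<lambda>s. \<Sum>A - s) ` restricted_sumset k A \<subseteq> restricted_sumset h A"
    using *[of k h] card_A by (force simp: add.commute)
qed

lemma card_le_crit_num:
  fixes A :: "'a::{ab_group_add, finite} set"
  assumes "restricted_sumset h A \<noteq> UNIV"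
  shows "card A \<le> crit_num TYPE('a) h"
  unfolding crit_num_def using assms by (intro Max_ge) auto

lemma crit_num_le:
  assumes "1 \<le> h"
    and "\<And>A :: 'a::{ab_group_add, finite} set. m < card A \<Longrightarrow> restricted_sumset h A = UNIV"
  shows "crit_num TYPE('a) h \<le> m"
proof -
  \<comment> \<open>This keeps the family under \<open>Max\<close> nonempty; with
    \<open>h = 0\<close> it would fail in the trivial group.\<close>
  have "restricted_sumset h ({} :: 'a set) \<noteq> UNIV"
    using \<open>1 \<le> h\<close> by (auto simp: restricted_sumset_def)
  then show ?thesis
    unfolding crit_num_def using assms(2) by (subst Max_le_iff) (auto intro: leI)
qed

text \<open>A representation of \<open>g - a\<close> that avoids \<open>a\<close> stays a sum of
  distinct elements when \<open>a\<close> is put back.\<close>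

lemma restricted_sumset_Suc:
  fixes A :: "'a::{ab_group_add, finite} set"
  assumes "a \<in> A" and "restricted_sumset h (A - {a}) = UNIV"
  shows "restricted_sumset (Suc h) A = UNIV"
proof -
  have "g \<in> restricted_sumset (Suc h) A" for g
  proof -
    have "g - a \<in> restricted_sumset h (A - {a})"
      using assms by simp
    then obtain B where B: "B \<subseteq> A - {a}" "card B = h" "g - a = \<Sum>B"
      unfolding restricted_sumset_def by blast
    then have "a \<notin> B" by blast
    then have "card (insert a B) = Suc h" "\<Sum>(insert a B) = a + \<Sum>B"
      using B(2) by simp_all
    then have "card (insert a B) = Suc h" "\<Sum>(insert a B) = g"
      using B(3)[symmetric] by simp_all
    then show ?thesis
      unfolding restricted_sumset_def using B(1) \<open>a \<in> A\<close>
      by (intro CollectI exI[of _ "insert a B"]) auto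
  qed
  then show ?thesis by blast
qed

context
  assumes elementary: "\<And>x :: 'a::{ab_group_add, finite}. x + x = 0"
begin

lemma add_add_cancel_2: "x + (x + y) = (y :: 'a)"
  by (simp add: elementary flip: add.assoc)

lemma add_eq_0_iff_2: "x + y = 0 \<longleftrightarrow> x = (y :: 'a)"
  by (metis add_add_cancel_2 elementary)

lemma restricted_sumset_3_eq_UNIV:
  fixes A :: "'a set"
  assumes "CARD('a) + 4 \<le> 2 * card A"
  shows "restricted_sumset 3 A = UNIV"
proof -
  have "g \<in> restricted_sumset 3 A" for g
  proof -
    \<comment> \<open>Since \<open>g + g + g = g\<close>, three elements of \<open>A\<close> sum to
      \<open>g\<close> exactly when their translates by \<open>g\<close> sum to 0.\<close>
    define B where "B = (+) g ` A - {0}"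
    have "card ((+) g ` A) = card A"
      by (simp add: card_image)
    then have "card A \<le> card B + 1"
      unfolding B_def using diff_card_le_card_Diff[of "{0}" "(+) g ` A"] by simp
    then have card_B: "CARD('a) < card B + card B"
      using assms by simp
    then obtain c where c: "c \<in> B"
      by fastforce
    have "card ((+) c ` B) = card B"
      by (simp add: card_image)
    have "B \<inter> (+) c ` B \<noteq> {}"
    proof
      assume "B \<inter> (+) c ` B = {}"
      then have "card (B \<union> (+) c ` B) = card B + card B"
        using \<open>card ((+) c ` B) = card B\<close> by (simp add: card_Un_disjoint)
      moreover have "card (B \<union> (+) c ` B) \<le> CARD('a)"
        by (simp add: card_mono)
      ultimately show False
        using card_B by simp
    qed
    then obtain b where b: "b \<in> B" "c + b \<in> B"
      by auto
    have in_A: "g + x \<in> A" if "x \<in> B" for x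
      using that by (auto simp: B_def add_add_cancel_2)
    have "0 \<notin> B"
      by (simp add: B_def)
    \<comment> \<open>Here the removal of 0 pays off: \<open>c\<close>, \<open>b\<close> and
      \<open>c + b\<close> are all nonzero, which is just what makes them pairwise distinct.\<close>
    then have "b \<noteq> 0" "c \<noteq> 0" "b \<noteq> c"
      using b c elementary by auto
    then have distinct: "g + c \<noteq> g + b" "g + c \<noteq> g + (c + b)" "g + b \<noteq> g + (c + b)"
      by auto
    let ?T = "{g + c, g + b, g + (c + b)}"
    have "\<Sum>?T = (g + c) + ((g + b) + (g + (c + b)))"
      using distinct by simp
    also have "\<dots> = g + ((g + g) + ((c + c) + (b + b)))"
      by (simp only: ac_simps)
    also have "\<dots> = g"
      by (simp add: elementary)
    finally have "\<Sum>?T = g" .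
    moreover have "?T \<subseteq> A"
      using in_A b c by blast
    moreover have "card ?T = 3"
      using distinct by simp
    ultimately show ?thesis
      unfolding restricted_sumset_def by (intro CollectI exI[of _ ?T]) auto
  qed
  then show ?thesis by blast
qed

text \<open>Removing one element lowers \<open>2 * card A\<close> by 2, as does passing from
  \<open>Suc h\<close> to \<open>h\<close>, so the size condition survives the induction down to 3
  summands.\<close>

lemma restricted_sumset_eq_UNIV:
  fixes A :: "'a set"
  assumes "3 \<le> h" and "CARD('a) + 2 * h \<le> 2 * card A + 2"
  shows "restricted_sumset h A = UNIV"
  using assms
proof (induction h arbitrary: A rule: dec_induct)
  case base
  then show ?case
    by (intro restricted_sumset_3_eq_UNIV) simp
next
  case (step h)
  then have "A \<noteq> {}" by auto
  then obtain a where "a \<in> A" by blast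
  then have "card A = Suc (card (A - {a}))"
    by (rule card.remove[OF finite])
  then show ?case
    using step by (intro restricted_sumset_Suc[OF \<open>a \<in> A\<close>] step.IH) simp
qed

lemma crit_num_large:
  assumes "1 \<le> h" and lower: "CARD('a) \<le> 2 * h + 2" and upper: "h + 2 \<le> CARD('a)"
  shows "crit_num TYPE('a) h = h + 2"
proof (rule antisym)
  show "crit_num TYPE('a) h \<le> h + 2"
  proof (rule crit_num_le[OF \<open>1 \<le> h\<close>])
    fix A :: "'a set"
    assume "h + 2 < card A"
    \<comment> \<open>Size \<open>h + 3\<close> makes \<open>h\<close>-fold sums complementary to
      3-fold ones, and \<open>lower\<close> then gives exactly
      \<open>CARD('a) + 4 \<le> 2 * card B\<close>.\<close>
    then obtain B where B: "B \<subseteq> A" "card B = h + 3"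
      using obtain_subset_with_card_n[of "h + 3" A] by auto
    have "restricted_sumset 3 B = UNIV"
      using B lower by (intro restricted_sumset_3_eq_UNIV) simp
    moreover have "surj (\<lambda>s. \<Sum>B - s)"
      by (rule surjI[of _ "\<lambda>s. \<Sum>B - s"]) simp
    ultimately have "restricted_sumset h B = UNIV"
      using restricted_sumset_complement[of B h 3] B by simp
    then show "restricted_sumset h A = UNIV"
      using restricted_sumset_mono[OF B(1), of h] by blast
  qed
next
  obtain A :: "'a set" where A: "card A = h + 2"
    using obtain_subset_with_card_n[OF upper] by blast
  \<comment> \<open>Distinct elements never sum to 0 because each is its own negative; the
    complement map sends this missed 0 to a missed \<open>\<Sum>A\<close>.\<close>
  have "0 \<notin> restricted_sumset 2 A"
  proof
    assume "0 \<in> restricted_sumset 2 A"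
    then obtain B :: "'a set" where "card B = 2" "\<Sum>B = 0"
      unfolding restricted_sumset_def by force
    then obtain x y where "B = {x, y}" "x \<noteq> y"
      by (meson card_2_iff)
    then show False
      using \<open>\<Sum>B = 0\<close> by (simp add: add_eq_0_iff_2)
  qed
  then have "\<Sum>A \<notin> restricted_sumset h A"
    using restricted_sumset_complement[of A h 2] A by auto
  then have "restricted_sumset h A \<noteq> UNIV" by blast
  then show "h + 2 \<le> crit_num TYPE('a) h"
    using card_le_crit_num A by metis
qed

text \<open>Adjoining \<open>z\<close> to a maximal proper subgroup \<open>H\<close> yields only
  \<open>H\<close> and the coset \<open>z + H\<close>, because \<open>z + z = 0\<close>. By
  maximality these two cover the group, so \<open>H\<close> has at least half of its
  elements.\<close>

lemma exists_large_proper_subgroup: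
  assumes "2 \<le> CARD('a)"
  obtains H :: "'a set"
  where "0 \<in> H" "\<And>x y. x \<in> H \<Longrightarrow> y \<in> H \<Longrightarrow> x + y \<in> H" "H \<noteq> UNIV" "CARD('a) \<le> 2 * card H"
proof -
  \<comment> \<open>Closure under negation is automatic, as \<open>- x = x\<close>.\<close>
  define F where "F = {H :: 'a set. 0 \<in> H \<and> (\<forall>x\<in>H. \<forall>y\<in>H. x + y \<in> H) \<and> H \<noteq> UNIV}"
  have "{0} \<noteq> (UNIV :: 'a set)"
  proof
    assume "{0} = (UNIV :: 'a set)"
    then have "CARD('a) = card {0 :: 'a}" by simp
    then show False using assms by simp
  qed
  then have "{0} \<in> F"
    by (auto simp: F_def)
  then obtain H where "H \<in> F" and maximal: "\<And>K. K \<in> F \<Longrightarrow> H \<subseteq> K \<Longrightarrow> H = K"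
    using finite_has_maximal[of F] by auto
  then have H: "0 \<in> H" "\<And>x y. x \<in> H \<Longrightarrow> y \<in> H \<Longrightarrow> x + y \<in> H" "H \<noteq> UNIV"
    by (auto simp: F_def)
  then obtain z where "z \<notin> H" by blast
  define K where "K = H \<union> (+) z ` H"
  have "x + y \<in> K" if "x \<in> K" "y \<in> K" for x y
  proof -
    have "u + (z + v) = z + (u + v)" "(z + u) + v = z + (u + v)" for u v
      by (simp_all only: ac_simps)
    moreover have "(z + u) + (z + v) = u + v" for u v
      using add_add_cancel_2[of z "u + v"] by (simp only: ac_simps)
    ultimately show ?thesis
      using that H(2) unfolding K_def by (smt (verit) Un_iff image_iff)
  qed
  moreover have "0 \<in> K" "H \<subseteq> K" "z \<in> K"
    using H(1) by (auto simp: K_def image_iff)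
  ultimately have "K = UNIV"
    using maximal[of K] \<open>z \<notin> H\<close> unfolding F_def by blast
  moreover have "card K \<le> card H + card H"
    unfolding K_def by (rule card_Un_le[THEN order_trans]) (simp add: card_image_le)
  ultimately show thesis
    using that[of H] H by simp
qed

text \<open>Sums of elements of a proper subgroup never leave it, whatever the number of
  summands.\<close>

lemma half_card_le_crit_num:
  assumes "2 \<le> CARD('a)"
  shows "CARD('a) \<le> 2 * crit_num TYPE('a) h"
proof -
  obtain H :: "'a set" where H: "0 \<in> H" "\<And>x y. x \<in> H \<Longrightarrow> y \<in> H \<Longrightarrow> x + y \<in> H" "H \<noteq> UNIV"
    and card_H: "CARD('a) \<le> 2 * card H"
    using exists_large_proper_subgroup[OF assms] by metis
  have "\<Sum>B \<in> H" if "B \<subseteq> H" for B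
    using finite[of B] that by (induction B rule: finite_induct) (auto simp: H)
  then have "restricted_sumset h H \<subseteq> H"
    by (auto simp: restricted_sumset_def)
  then show ?thesis
    using card_le_crit_num[of h H] H(3) card_H by fastforce
qed

end

theorem theorem2p9:
  fixes n r :: nat
  assumes elementary: "\<And>x :: 'a::{ab_group_add, finite}. x + x = 0"
    and order: "CARD('a) = n" "n = 2 ^ r"
  shows "(\<forall>h::nat. 1 \<le> h \<and> real n / 2 - 1 \<le> real h \<and> real h \<le> real n - 2 \<longrightarrow>
            crit_num TYPE('a) h = h + 2) \<and>
         (\<forall>h::nat. 4 \<le> h \<and> real h \<le> real n / 2 - 2 \<longrightarrow>
            real n / 2 \<le> real (crit_num TYPE('a) h) \<and>
            real (crit_num TYPE('a) h) \<le> real n / 2 + real h - 2)"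
proof (intro conjI allI impI; elim conjE)
  fix h :: nat
  assume "1 \<le> h" "real n / 2 - 1 \<le> real h" "real h \<le> real n - 2"
  then show "crit_num TYPE('a) h = h + 2"
    using order(1) by (intro crit_num_large elementary) linarith+
next
  fix h :: nat
  assume "4 \<le> h" and h: "real h \<le> real n / 2 - 2"
  then have "2 \<le> n" by linarith
  then show "real n / 2 \<le> real (crit_num TYPE('a) h)"
    using half_card_le_crit_num[OF elementary, of h] order(1) by linarith
  \<comment> \<open>Evenness of \<open>n\<close> lets \<open>n / 2\<close> be handled as a natural
    number \<open>m\<close>.\<close>
  from \<open>2 \<le> n\<close> have "r \<noteq> 0"
    using order(2) by (intro notI) simp
  then obtain m where m: "n = 2 * m"
    using order(2) by (cases r) auto
  \<comment> \<open>The subtraction does not truncate, as \<open>4 \<le> h\<close>. A larger set has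
    at least \<open>m + h - 1\<close> elements, which is the threshold
    \<open>CARD('a) + 2 * h \<le> 2 * card A + 2\<close>.\<close>
  have "crit_num TYPE('a) h \<le> m + h - 2"
  proof (rule crit_num_le)
    fix A :: "'a set"
    assume "m + h - 2 < card A"
    then show "restricted_sumset h A = UNIV"
      using \<open>4 \<le> h\<close> m order(1)
      by (intro restricted_sumset_eq_UNIV elementary) linarith+
  qed (use \<open>4 \<le> h\<close> in simp)
  then have "crit_num TYPE('a) h + 2 \<le> m + h"
    using \<open>4 \<le> h\<close> by linarith
  then show "real (crit_num TYPE('a) h) \<le> real n / 2 + real h - 2"
    using m by simp
qed

end
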